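(* Let $A$ be a $d\times n$ integer matrix and let $c\in\mathbb{Q}^n$ be such that the integer programs with matrix $A$ and cost vector $c$ are bounded. Then the integer programming gap $\mathrm{gap}(A,c)$ equals the maximum, over all irreducible components $I$ of the monomial ideal $M(A,c)$, of the gap value of $I$ with respect to $A$ and $c$.
   Context: For $b\in\mathbb{Z}^d$, the integer program is: minimize $c\cdot u$ subject to $A u=b$, $u\ge 0$, $u\in\mathbb{Z}^n$. Its linear programming relaxation is: minimize $c\cdot u$ subject to $A u=b$, $u\ge 0$, $u\in\mathbb{R}^n$. If the integer program is feasible and bounded, so is its relaxation. $\mathrm{gap}(A,c)$ denotes the maximum of (optimal value of the integer program) $-$ (optimal value of its linear relaxation), as $b$ ranges over all vectors in $\mathbb{Z}^d$ for which the integer program is feasible and bounded. A vector $u\in\mathbb{N}^n$ ($\mathbb{N}=\{0,1,2,\dots\}$) is non-optimal if it is not an optimal solution of the integer program with right-hand side $b=A u$. $M(A,c)$ is the ideal of $\mathbb{R}[x_1,\dots,x_n]$ generated by all monomials $x^u=x_1^{u_1}\cdots x_n^{u_n}$ with $u\in\mathbb{N}^n$ non-optimal. A monomial ideal is irreducible if it is generated by powers of variables, i.e. has the form $I=\langle x_{i_1}^{u_{i_1}+1},\dots,x_{i_r}^{u_{i_r}+1}\rangle$ with $u_{i_1},\dots,u_{i_r}\in\mathbb{N}$. Every monomial ideal is uniquely an irredundant intersection of finitely many irreducible monomial ideals, called its irreducible components. The gap value of an irreducible component $I=\langle x_{i_1}^{u_{i_1}+1},\dots,x_{i_r}^{u_{i_r}+1}\rangle$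 of $M(A,c)$ with respect to $A$ and $c$ is the optimal value of the linear program in the variable $v\in\mathbb{R}^n$: maximize $u_{i_1}c_{i_1}+\cdots+u_{i_r}c_{i_r}-c\cdot v$ subject to $A v=u_{i_1}A_{i_1}+\cdots+u_{i_r}A_{i_r}$ and $v_{i_1},\dots,v_{i_r}\ge 0$, where $A_1,\dots,A_n$ are the columns of $A$ (the coordinates $v_j$ with $j\notin\{i_1,\dots,i_r\}$ are unrestricted in sign). *)

theory Defs
  imports "HOL-Analysis.Analysis" "HOL-Library.Poly_Mapping"
begin

text \<open>
  The optimal value of an optimization problem is a relation between the problem and a
  real number: it relates nothing if no optimal solution exists. \<open>is_maximum_of val X m\<close>
  says that every \<open>x \<in> X\<close> has a value, and that \<open>m\<close> is the largest of these values.
\<close>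

definition is_maximum_of :: "('a \<Rightarrow> real \<Rightarrow> bool) \<Rightarrow> 'a set \<Rightarrow> real \<Rightarrow> bool" where
  "is_maximum_of val X m \<longleftrightarrow>
     (\<forall>x\<in>X. \<exists>z. val x z) \<and> (\<exists>x\<in>X. val x m) \<and> (\<forall>x\<in>X. \<forall>z. val x z \<longrightarrow> z \<le> m)"

definition real_vec :: "int ^ 'n \<Rightarrow> real ^ 'n" where
  "real_vec u = (\<chi> i. real_of_int (u $ i))"

definition real_mat :: "int ^ 'n ^ 'd \<Rightarrow> real ^ 'n ^ 'd" where
  "real_mat A = map_matrix real_of_int A"

definition int_vec :: "nat ^ 'n \<Rightarrow> int ^ 'n" where
  "int_vec u = (\<chi> i. int (u $ i))"


section \<open>Integer programs, linear relaxations, and the gap\<close>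

definition ip_feasible :: "int ^ 'n ^ 'd \<Rightarrow> int ^ 'd \<Rightarrow> int ^ 'n \<Rightarrow> bool" where
  "ip_feasible A b u \<longleftrightarrow> A *v u = b \<and> (\<forall>i. 0 \<le> u $ i)"

definition lp_feasible :: "int ^ 'n ^ 'd \<Rightarrow> int ^ 'd \<Rightarrow> real ^ 'n \<Rightarrow> bool" where
  "lp_feasible A b u \<longleftrightarrow> real_mat A *v u = real_vec b \<and> (\<forall>i. 0 \<le> u $ i)"

text \<open>An infeasible program counts as bounded.\<close>

definition ip_bounded :: "int ^ 'n ^ 'd \<Rightarrow> real ^ 'n \<Rightarrow> int ^ 'd \<Rightarrow> bool" where
  "ip_bounded A c b \<longleftrightarrow> bdd_below {c \<bullet> real_vec u | u. ip_feasible A b u}"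

definition ip_optimal :: "int ^ 'n ^ 'd \<Rightarrow> real ^ 'n \<Rightarrow> int ^ 'd \<Rightarrow> int ^ 'n \<Rightarrow> bool" where
  "ip_optimal A c b = is_arg_min (\<lambda>u. c \<bullet> real_vec u) (ip_feasible A b)"

definition lp_optimal :: "int ^ 'n ^ 'd \<Rightarrow> real ^ 'n \<Rightarrow> int ^ 'd \<Rightarrow> real ^ 'n \<Rightarrow> bool" where
  "lp_optimal A c b = is_arg_min (\<lambda>u. c \<bullet> u) (lp_feasible A b)"

definition is_ip_lp_difference ::
    "int ^ 'n ^ 'd \<Rightarrow> real ^ 'n \<Rightarrow> int ^ 'd \<Rightarrow> real \<Rightarrow> bool" where
  "is_ip_lp_difference A c b z \<longleftrightarrow>
     (\<exists>u v. ip_optimal A c b u \<and> lp_optimal A c b v \<and> z = c \<bullet> real_vec u - c \<bullet> v)"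

definition is_gap :: "int ^ 'n ^ 'd \<Rightarrow> real ^ 'n \<Rightarrow> real \<Rightarrow> bool" where
  "is_gap A c =
     is_maximum_of (is_ip_lp_difference A c) {b. (\<exists>u. ip_feasible A b u) \<and> ip_bounded A c b}"


section \<open>Monomial ideals\<close>

text \<open>
  \<open>\<real>[x\<^sub>1,\<dots>,x\<^sub>n]\<close> is the monoid algebra of \<open>\<nat>\<^sup>n\<close>: finitely supported functions from exponent
  vectors to coefficients, with the convolution product of \<open>HOL-Library.Poly_Mapping\<close>.
\<close>

type_synonym 'n polyring = "(nat ^ 'n) \<Rightarrow>\<^sub>0 real"

definition xvar :: "'n::finite \<Rightarrow> 'n polyring" where
  "xvar i = Poly_Mapping.single (axis i 1) 1"

definition xpow :: "nat ^ 'n \<Rightarrow> ('n::finite) polyring" where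
  "xpow u = (\<Prod>i\<in>UNIV. xvar i ^ (u $ i))"

text \<open>An ideal is a submodule of the ring regarded as a module over itself.\<close>

definition ideal_generated :: "('n::finite) polyring set \<Rightarrow> 'n polyring set" where
  "ideal_generated = module.span (*)"

definition nonoptimal :: "int ^ 'n ^ 'd \<Rightarrow> real ^ 'n \<Rightarrow> nat ^ 'n \<Rightarrow> bool" where
  "nonoptimal A c u \<longleftrightarrow> \<not> ip_optimal A c (A *v int_vec u) (int_vec u)"

definition nonoptimal_ideal :: "int ^ 'n ^ 'd \<Rightarrow> real ^ 'n \<Rightarrow> 'n polyring set" where
  "nonoptimal_ideal A c = ideal_generated {xpow u | u. nonoptimal A c u}"

text \<open>
  The ideal \<open>\<langle>x\<^sub>i\<^bsup>u\<^sub>i + 1\<^esup> | i \<in> \<sigma>\<rangle>\<close>; only the coordinates of \<open>u\<close> in \<open>\<sigma>\<close> matter. The set \<open>\<sigma>\<close> may be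
  empty: the zero ideal is irreducible, and it is the irreducible component of the zero ideal.
\<close>

definition irreducible_ideal :: "'n::finite set \<Rightarrow> nat ^ 'n \<Rightarrow> 'n polyring set" where
  "irreducible_ideal \<sigma> u = ideal_generated {xvar i ^ (u $ i + 1) | i. i \<in> \<sigma>}"

definition irredundant_decomposition ::
    "('n::finite) polyring set \<Rightarrow> 'n polyring set set \<Rightarrow> bool" where
  "irredundant_decomposition M C \<longleftrightarrow>
     finite C \<and> (\<forall>I\<in>C. \<exists>\<sigma> u. I = irreducible_ideal \<sigma> u) \<and> \<Inter>C = M \<and> (\<forall>I\<in>C. \<Inter>(C - {I}) \<noteq> M)"

text \<open>The irredundant decomposition of a monomial ideal is unique, so the union has one term.\<close>

definition irreducible_components :: "('n::finite) polyring set \<Rightarrow> 'n polyring set set" where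
  "irreducible_components M = \<Union>{C. irredundant_decomposition M C}"


section \<open>The gap value of an irreducible component\<close>

definition gap_lp_feasible ::
    "int ^ 'n ^ 'd \<Rightarrow> 'n set \<Rightarrow> nat ^ 'n \<Rightarrow> real ^ 'n \<Rightarrow> bool" where
  "gap_lp_feasible A \<sigma> u v \<longleftrightarrow>
     real_mat A *v v = (\<Sum>i\<in>\<sigma>. real (u $ i) *\<^sub>R column i (real_mat A)) \<and> (\<forall>i\<in>\<sigma>. 0 \<le> v $ i)"

definition gap_lp_objective :: "real ^ 'n \<Rightarrow> 'n set \<Rightarrow> nat ^ 'n \<Rightarrow> real ^ 'n \<Rightarrow> real" where
  "gap_lp_objective c \<sigma> u v = (\<Sum>i\<in>\<sigma>. real (u $ i) * c $ i) - c \<bullet> v"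

text \<open>
  The ideal \<open>I\<close> determines \<open>\<sigma>\<close> and the coordinates of \<open>u\<close> in \<open>\<sigma>\<close>, hence the linear program.
\<close>

definition is_gap_value ::
    "int ^ 'n ^ 'd \<Rightarrow> real ^ 'n \<Rightarrow> 'n polyring set \<Rightarrow> real \<Rightarrow> bool" where
  "is_gap_value A c I z \<longleftrightarrow>
     (\<exists>\<sigma> u v. I = irreducible_ideal \<sigma> u \<and>
        is_arg_max (gap_lp_objective c \<sigma> u) (gap_lp_feasible A \<sigma> u) v \<and>
        z = gap_lp_objective c \<sigma> u v)"

end

theory Submission
  imports Defs
begin

text \<open>
  Call an exponent vector optimal if it is not non-optimal. Adding a vector to a non-optimal one
  keeps it non-optimal, so \<open>M(A,c)\<close> consists of the polynomials supported on non-optimal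
  exponents. The monomials outside an irreducible ideal form a box \<open>{w. w\<^sub>i \<le> u\<^sub>i for i \<in> \<sigma>}\<close>, unbounded
  in the directions outside \<open>\<sigma>\<close>. Writing \<open>M(A,c)\<close> as an intersection of irreducible ideals thus
  means covering the optimal exponents by boxes of optimal exponents.

  Such a box and its linear program match the differences between integer programs and their
  relaxations as follows. Let \<open>u\<^sub>\<sigma>\<close> be \<open>u\<close> with the coordinates outside \<open>\<sigma>\<close> set to zero. If \<open>w\<close> lies in the
  box, \<open>v \<mapsto> v + (u\<^sub>\<sigma> - w)\<close> carries feasible points of the relaxation at \<open>A w\<close> to feasible points of
  the linear program of the box: on \<open>\<sigma>\<close> the shift is nonnegative, and off \<open>\<sigma>\<close> signs are free. The
  objective value becomes \<open>c \<bullet> w - c \<bullet> v\<close>, so no difference exceeds the gap value of a component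
  whose box contains an integer optimum (\<open>difference_le_gap_value\<close>). Conversely, given a feasible
  \<open>v\<close> of the linear program of the box, choose \<open>w\<close> equal to \<open>u\<close> on \<open>\<sigma>\<close> and so large elsewhere that the
  inverse shift makes \<open>v\<close> nonnegative; \<open>w\<close> is still in the box, hence optimal, and the difference
  at \<open>A w\<close> is at least the objective value of \<open>v\<close> (\<open>gap_lp_le_difference\<close>).

  It remains to see that all these optima exist. A finite decomposition comes from Dickson's lemma
  (\<open>irredundant_decomposition_exists\<close>). A feasible linear program with an integer matrix and a rational
  cost vector either attains its minimum or has an integer ray of negative cost
  (\<open>lp_minimum_exists\<close>); a ray for the program of a box of optimal exponents would improve a vector
  in the box (\<open>recession_cost_nonneg\<close>). Integer programs attain their infimum since their costs have
  a common denominator. The gap is then the largest gap value in one finite decomposition.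
\<close>

section \<open>Monomial ideals\<close>

lemma module_polyring: "module ((*) :: ('n::finite) polyring \<Rightarrow> 'n polyring \<Rightarrow> 'n polyring)"
  by unfold_locales (simp_all add: algebra_simps)

lemma xvar_power: "xvar i ^ k = Poly_Mapping.single (axis i k) 1"
proof (induction k)
  case 0
  have "axis i 0 = (0 :: nat ^ 'a)" by (simp add: axis_def vec_eq_iff)
  then show ?case by (simp only: power_0 single_one)
next
  case (Suc k)
  have "axis i 1 + axis i k = (axis i (Suc k) :: nat ^ 'a)" by (simp add: axis_def vec_eq_iff)
  moreover have "xvar i ^ Suc k = xvar i * Poly_Mapping.single (axis i k) 1"
    by (simp only: power_Suc Suc.IH)
  ultimately show ?case by (simp only: xvar_def mult_single mult_1)
qed

lemma xpow_eq_single: "xpow u = Poly_Mapping.single u 1"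
proof -
  have "(\<Prod>i\<in>F. xvar i ^ (u $ i)) = Poly_Mapping.single (\<Sum>i\<in>F. axis i (u $ i)) 1"
    if "finite F" for F
    using that by (induction F) (simp_all add: xvar_power mult_single)
  moreover have "(\<Sum>i\<in>UNIV. axis i (u $ i)) = u"
    by (simp add: vec_eq_iff axis_def sum.delta')
  ultimately show ?thesis by (simp add: xpow_def)
qed

lemma poly_mapping_eq_sum_single:
  "p = (\<Sum>w\<in>Poly_Mapping.keys p. Poly_Mapping.single w (Poly_Mapping.lookup p w))"
  by (rule poly_mapping_eqI) (simp add: lookup_sum lookup_single when_def in_keys_iff)

text \<open>
  Membership in a monomial ideal depends on the support alone. The polynomials supported on
  multiples of the generators form an ideal because the support of a product lies in the sum of the
  supports, and each of their terms is a multiple of one generator.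
\<close>

lemma ideal_generated_monomials:
  fixes U :: "(nat ^ 'n::finite) set"
  shows "ideal_generated ((\<lambda>u. Poly_Mapping.single u 1) ` U) =
    {p. \<forall>w \<in> Poly_Mapping.keys p. \<exists>u\<in>U. \<exists>z. w = z + u}" (is "ideal_generated ?G = ?I")
proof -
  interpret module "(*) :: ('n::finite) polyring \<Rightarrow> 'n polyring \<Rightarrow> 'n polyring"
    by (rule module_polyring)
  show ?thesis
    unfolding ideal_generated_def
  proof
    have "?G \<subseteq> ?I" by auto (metis add_0)
    moreover have "subspace ?I"
    proof (rule subspaceI)
      fix p q :: "'n polyring" assume "p \<in> ?I" "q \<in> ?I"
      then show "p + q \<in> ?I" using keys_add[of p q] by auto
    next
      fix p q :: "'n polyring" assume q: "q \<in> ?I"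
      have "\<exists>u\<in>U. \<exists>z. w = z + u" if w: "w \<in> Poly_Mapping.keys (p * q)" for w
      proof -
        obtain a b where "w = a + b" "b \<in> Poly_Mapping.keys q" using keys_mult w by blast
        then obtain u z where "u \<in> U" "w = a + (z + u)" using q by auto
        then show ?thesis by (metis add.assoc)
      qed
      then show "p * q \<in> ?I" by auto
    qed simp
    ultimately show "span ?G \<subseteq> ?I" by (rule span_minimal)
    show "?I \<subseteq> span ?G"
    proof
      fix p assume p: "p \<in> ?I"
      have "Poly_Mapping.single w a \<in> span ?G" if w: "w \<in> Poly_Mapping.keys p" for w a
      proof -
        obtain u z where u: "u \<in> U" "w = z + u" using p w by auto
        have "Poly_Mapping.single z a * Poly_Mapping.single u 1 \<in> span ?G"
          using u by (intro span_scale span_base) auto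
        then show ?thesis by (simp add: mult_single u)
      qed
      then have "(\<Sum>w\<in>Poly_Mapping.keys p. Poly_Mapping.single w (Poly_Mapping.lookup p w)) \<in> span ?G"
        by (intro span_sum)
      then show "p \<in> span ?G" by (simp flip: poly_mapping_eq_sum_single)
    qed
  qed
qed

text \<open>The exponents of the standard monomials of an irreducible ideal, that is, of those outside it.\<close>

definition standard_box :: "'n::finite set \<Rightarrow> nat ^ 'n \<Rightarrow> (nat ^ 'n) set" where
  "standard_box \<sigma> u = {w. \<forall>i\<in>\<sigma>. w $ i \<le> u $ i}"

lemma irreducible_ideal_eq:
  "irreducible_ideal \<sigma> u = {p. Poly_Mapping.keys p \<inter> standard_box \<sigma> u = {}}"
proof -
  have "{xvar i ^ (u $ i + 1) | i. i \<in> \<sigma>} =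
      (\<lambda>v. Poly_Mapping.single v 1) ` ((\<lambda>i. axis i (u $ i + 1)) ` \<sigma>)"
    by (auto simp: xvar_power simp del: power_Suc)
  moreover have "(\<exists>v\<in>(\<lambda>i. axis i (u $ i + 1)) ` \<sigma>. \<exists>z. w = z + v) \<longleftrightarrow> (\<exists>i\<in>\<sigma>. u $ i < w $ i)" for w
  proof
    assume "\<exists>i\<in>\<sigma>. u $ i < w $ i"
    then obtain i where i: "i \<in> \<sigma>" "u $ i < w $ i" by blast
    then have "w = (w - axis i (u $ i + 1)) + axis i (u $ i + 1)"
      by (auto simp: vec_eq_iff axis_def)
    then show "\<exists>v\<in>(\<lambda>i. axis i (u $ i + 1)) ` \<sigma>. \<exists>z. w = z + v" using i by blast
  qed (auto simp: axis_def)
  ultimately show ?thesis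
    unfolding irreducible_ideal_def
    by (auto simp: ideal_generated_monomials standard_box_def disjoint_iff not_le)
qed

text \<open>
  The vector on the \<open>i\<close>-th axis chosen in the proof sits at the edge of the first box if \<open>i\<close> is
  bounded there, and just beyond the edge of the second box otherwise.
\<close>

lemma standard_box_subset:
  assumes sub: "standard_box \<sigma> u \<subseteq> standard_box \<tau> v" and i: "i \<in> \<tau>"
  shows "i \<in> \<sigma> \<and> u $ i \<le> v $ i"
proof -
  have "axis i (if i \<in> \<sigma> then u $ i else v $ i + 1) \<in> standard_box \<sigma> u"
    by (auto simp: standard_box_def axis_def)
  then have "axis i (if i \<in> \<sigma> then u $ i else v $ i + 1) \<in> standard_box \<tau> v"
    using sub by blast
  then show ?thesis using i by (force simp: standard_box_def axis_def split: if_splits)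
qed

text \<open>This makes the gap value of a component independent of how the component is presented.\<close>

lemma irreducible_ideal_unique:
  assumes "irreducible_ideal \<sigma> u = irreducible_ideal \<tau> v"
  shows "\<sigma> = \<tau>" and "\<forall>i\<in>\<sigma>. u $ i = v $ i"
proof -
  have box: "w \<in> standard_box \<sigma>' u' \<longleftrightarrow> Poly_Mapping.single w 1 \<notin> irreducible_ideal \<sigma>' u'" for w \<sigma>' u'
    by (simp add: irreducible_ideal_eq)
  have "standard_box \<sigma> u = standard_box \<tau> v" using assms box by blast
  then show "\<sigma> = \<tau>" "\<forall>i\<in>\<sigma>. u $ i = v $ i"
    using standard_box_subset[of \<sigma> u \<tau> v] standard_box_subset[of \<tau> v \<sigma> u] by (auto intro: order_antisym)
qed

section \<open>Finite irreducible decompositions\<close>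

text \<open>
  Dickson's lemma. The induction adds one coordinate \<open>k\<close> at a time: take a finite set \<open>G\<close> that works when
  \<open>k\<close> is ignored. It still works for members of \<open>N\<close> whose coordinate \<open>k\<close> is at least the maximum over \<open>G\<close>.
\<close>

lemma dickson:
  fixes N :: "(nat ^ 'n::finite) set"
  shows "\<exists>G. finite G \<and> G \<subseteq> N \<and> (\<forall>w\<in>N. \<exists>g\<in>G. \<forall>i. g $ i \<le> w $ i)"
proof -
  have "\<exists>G. finite G \<and> G \<subseteq> N \<and> (\<forall>w\<in>N. \<exists>g\<in>G. \<forall>i\<in>K. g $ i \<le> w $ i)"
    if "finite K" for K and N :: "(nat ^ 'n) set"
    using that
  proof (induction K arbitrary: N)
    case empty
    show ?case
    proof (cases "N = {}")
      case False
      then obtain g where "g \<in> N" by blast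
      then show ?thesis by (intro exI[of _ "{g}"]) auto
    qed auto
  next
    case (insert k K)
    obtain G where G: "finite G" "G \<subseteq> N" "\<forall>w\<in>N. \<exists>g\<in>G. \<forall>i\<in>K. g $ i \<le> w $ i"
      using insert.IH[of N] by blast
    obtain m where m: "\<forall>g\<in>G. g $ k \<le> m"
      using finite_imageI[OF G(1), of "\<lambda>g. g $ k"] finite_nat_set_iff_bounded_le by auto
    \<comment> \<open>The other members fall into the finitely many slices \<open>w $ k = j < m\<close>, where \<open>k\<close> is constant.\<close>
    have "\<forall>j. \<exists>H. finite H \<and> H \<subseteq> {w\<in>N. w $ k = j} \<and>
        (\<forall>w\<in>{w\<in>N. w $ k = j}. \<exists>g\<in>H. \<forall>i\<in>K. g $ i \<le> w $ i)"
      by (intro allI insert.IH)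
    from choice[OF this] obtain H where "\<forall>j. finite (H j) \<and> H j \<subseteq> {w\<in>N. w $ k = j} \<and>
        (\<forall>w\<in>{w\<in>N. w $ k = j}. \<exists>g\<in>H j. \<forall>i\<in>K. g $ i \<le> w $ i)" ..
    then have H: "finite (H j)" "H j \<subseteq> {w\<in>N. w $ k = j}"
        "\<forall>w\<in>{w\<in>N. w $ k = j}. \<exists>g\<in>H j. \<forall>i\<in>K. g $ i \<le> w $ i" for j
      by simp_all
    show ?case
    proof (intro exI[of _ "G \<union> (\<Union>j<m. H j)"] conjI ballI)
      fix w assume w: "w \<in> N"
      show "\<exists>g\<in>G \<union> (\<Union>j<m. H j). \<forall>i\<in>insert k K. g $ i \<le> w $ i"
      proof (cases "w $ k < m")
        case True
        obtain g where "g \<in> H (w $ k)" "\<forall>i\<in>K. g $ i \<le> w $ i" using H(3)[of "w $ k"] w by blast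
        moreover have "g $ k = w $ k" using H(2)[of "w $ k"] \<open>g \<in> H (w $ k)\<close> by blast
        ultimately show ?thesis using True by (intro bexI[of _ g]) auto
      next
        case False
        obtain g where "g \<in> G" "\<forall>i\<in>K. g $ i \<le> w $ i" using G(3) w by blast
        moreover have "g $ k \<le> w $ k" using m \<open>g \<in> G\<close> False by fastforce
        ultimately show ?thesis by (intro bexI[of _ g]) auto
      qed
    next
      show "G \<union> (\<Union>j<m. H j) \<subseteq> N" using G(2) H(2) by blast
    qed (use G(1) H(1) in simp)
  qed
  from this[of UNIV N] show ?thesis by simp
qed

definition finite_box_union :: "(nat ^ 'n::finite) set \<Rightarrow> bool" where
  "finite_box_union X \<longleftrightarrow> (\<exists>B. finite B \<and> X = (\<Union>(\<sigma>, u)\<in>B. standard_box \<sigma> u))"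

lemma finite_box_union_Int:
  assumes "finite_box_union X" "finite_box_union Y"
  shows "finite_box_union (X \<inter> Y)"
proof -
  obtain B D where B: "finite B" "X = (\<Union>(\<sigma>, u)\<in>B. standard_box \<sigma> u)"
    and D: "finite D" "Y = (\<Union>(\<sigma>, u)\<in>D. standard_box \<sigma> u)"
    using assms unfolding finite_box_union_def by blast
  define meet :: "'a set \<times> (nat ^ 'a) \<Rightarrow> 'a set \<times> (nat ^ 'a) \<Rightarrow> 'a set \<times> (nat ^ 'a)" where
    "meet = (\<lambda>(\<sigma>, u) (\<tau>, v). (\<sigma> \<union> \<tau>,
       \<chi> i. if i \<in> \<sigma> \<and> i \<in> \<tau> then min (u $ i) (v $ i) else if i \<in> \<sigma> then u $ i else v $ i))"
  have "standard_box (\<sigma> \<union> \<tau>) (\<chi> i. if i \<in> \<sigma> \<and> i \<in> \<tau> then min (u $ i) (v $ i)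
        else if i \<in> \<sigma> then u $ i else v $ i) = standard_box \<sigma> u \<inter> standard_box \<tau> v"
    for \<sigma> \<tau> :: "'a set" and u v
    by (auto simp: standard_box_def split: if_splits)
  then have meet: "case_prod standard_box (meet p q) = case_prod standard_box p \<inter> case_prod standard_box q"
    for p q
    unfolding meet_def by (cases p, cases q) (simp only: prod.case)
  have "X \<inter> Y = (\<Union>p\<in>B. \<Union>q\<in>D. case_prod standard_box p \<inter> case_prod standard_box q)"
    unfolding B(2) D(2) by (rule Int_UN_distrib2)
  also have "\<dots> = (\<Union>p\<in>B. \<Union>q\<in>D. case_prod standard_box (meet p q))"
    by (simp only: meet)
  also have "\<dots> = (\<Union>(\<sigma>, u)\<in>(\<Union>p\<in>B. meet p ` D). standard_box \<sigma> u)"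
    by (simp only: UN_simps UN_UN_flatten)
  finally have eq: "X \<inter> Y = (\<Union>(\<sigma>, u)\<in>(\<Union>p\<in>B. meet p ` D). standard_box \<sigma> u)" .
  have "finite (\<Union>p\<in>B. meet p ` D)" using B(1) D(1) by simp
  then show ?thesis unfolding finite_box_union_def using eq by blast
qed

text \<open>
  Dickson's lemma gives a finite set \<open>G\<close> generating \<open>N\<close>. Avoiding the multiples of a single \<open>g\<close> means
  being below \<open>g\<close> in some coordinate, which is a finite union of boxes with one bounded direction;
  the complement of \<open>N\<close> is a finite intersection of such unions.
\<close>

lemma finite_box_union_Compl_upset:
  fixes N :: "(nat ^ 'n::finite) set"
  assumes up: "\<And>w z. w \<in> N \<Longrightarrow> z + w \<in> N"
  shows "finite_box_union (- N)"
proof -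
  obtain G where G: "finite G" "G \<subseteq> N" "\<forall>w\<in>N. \<exists>g\<in>G. \<forall>i. g $ i \<le> w $ i"
    using dickson[of N] by blast
  have above: "w \<in> N" if "g \<in> G" "\<forall>i. g $ i \<le> w $ i" for g w
  proof -
    have "w = (w - g) + g" using that by (simp add: vec_eq_iff)
    moreover have "(w - g) + g \<in> N" using up G(2) that(1) by blast
    ultimately show ?thesis by simp
  qed
  have "w \<in> - N \<longleftrightarrow> (\<forall>g\<in>G. \<exists>i. w $ i < g $ i)" for w
    using G(3) above[of _ w] by (meson Compl_iff not_less)
  then have "- N = (\<Inter>g\<in>G. {w. \<exists>i. w $ i < g $ i})" by blast
  moreover have "finite_box_union {w. \<exists>i. w $ i < g $ i}" for g :: "nat ^ 'n"
  proof -
    have "w $ i < g $ i \<longleftrightarrow> 0 < g $ i \<and> w $ i \<le> g $ i - 1" for w i by auto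
    then have "{w. \<exists>i. w $ i < g $ i} =
        (\<Union>(\<sigma>, u)\<in>(\<lambda>i. ({i}, \<chi> j. g $ j - 1)) ` {i. 0 < g $ i}. standard_box \<sigma> u)"
      by (simp add: standard_box_def) blast
    moreover have "finite ((\<lambda>i. ({i}, \<chi> j. g $ j - 1)) ` {i. 0 < g $ i})" by simp
    ultimately show ?thesis unfolding finite_box_union_def by blast
  qed
  moreover have UNIV: "finite_box_union (UNIV :: (nat ^ 'n) set)"
    unfolding finite_box_union_def
    by (intro exI[of _ "{({}, 0)}"]) (simp add: standard_box_def)
  have "finite_box_union (\<Inter>g\<in>F. X g)"
    if "finite F" "\<And>g. g \<in> F \<Longrightarrow> finite_box_union (X g)" for F and X :: "nat ^ 'n \<Rightarrow> (nat ^ 'n) set"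
    using that by (induction F rule: finite_induct) (simp_all add: UNIV finite_box_union_Int)
  ultimately show ?thesis using G(1) by simp
qed

text \<open>A finite decomposition with as few members as possible is irredundant.\<close>

lemma irredundant_decomposition_exists:
  fixes N :: "(nat ^ 'n::finite) set"
  assumes up: "\<And>w z. w \<in> N \<Longrightarrow> z + w \<in> N"
  shows "\<exists>C. irredundant_decomposition {p :: 'n polyring. Poly_Mapping.keys p \<subseteq> N} C"
proof -
  let ?M = "{p :: 'n polyring. Poly_Mapping.keys p \<subseteq> N}"
  define dec where "dec C \<longleftrightarrow> finite C \<and> (\<forall>I\<in>C. \<exists>\<sigma> u. I = irreducible_ideal \<sigma> u) \<and> \<Inter>C = ?M" for C
  obtain B where B: "finite B" "- N = (\<Union>(\<sigma>, u)\<in>B. standard_box \<sigma> u)"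
    using finite_box_union_Compl_upset[OF up] unfolding finite_box_union_def by blast
  have "?M = {p. Poly_Mapping.keys p \<inter> (- N) = {}}" by auto
  also have "\<dots> = (\<Inter>(\<sigma>, u)\<in>B. irreducible_ideal \<sigma> u)"
    unfolding B(2) irreducible_ideal_eq by auto
  finally have "dec ((\<lambda>(\<sigma>, u). irreducible_ideal \<sigma> u) ` B)"
    unfolding dec_def using B(1) by auto
  then obtain C where C: "dec C" and least: "\<forall>D. dec D \<longrightarrow> card C \<le> card D"
    using ex_has_least_nat[of dec _ card] by blast
  have "\<Inter>(C - {I}) \<noteq> ?M" if "I \<in> C" for I
  proof
    assume "\<Inter>(C - {I}) = ?M"
    then have "dec (C - {I})" using C by (simp add: dec_def)
    then have "card C \<le> card (C - {I})" using least by blast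
    moreover have "finite C" using C by (simp add: dec_def)
    ultimately show False using that card_Diff1_less[of C I] by simp
  qed
  then have "\<forall>I\<in>C. \<Inter>(C - {I}) \<noteq> ?M" by (rule ballI)
  with C have "irredundant_decomposition ?M C"
    unfolding irredundant_decomposition_def dec_def by (elim conjE) (intro conjI)
  then show ?thesis by (rule exI)
qed

section \<open>Linear programs with integer matrices\<close>

lemma real_mat_mult_real_vec: "real_mat A *v real_vec u = real_vec (A *v u)"
  by (simp add: real_mat_def real_vec_def map_matrix_def matrix_vector_mult_def vec_eq_iff)

lemma common_denominator:
  fixes f :: "'a \<Rightarrow> real"
  assumes "finite I" "\<forall>i\<in>I. f i \<in> \<rat>"
  shows "\<exists>N::nat. 0 < N \<and> (\<forall>i\<in>I. real N * f i \<in> \<int>)"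
  using assms
proof (induction I)
  case (insert i I)
  obtain N where N: "0 < N" "\<forall>i\<in>I. real N * f i \<in> \<int>" using insert by auto
  obtain a b :: int where ab: "0 < b" "f i = of_int a / of_int b"
    using insert.prems by (metis Rats_cases' insertI1)
  have "real (nat b * N) * f j \<in> \<int>" if "j \<in> insert i I" for j
  proof (cases "j = i")
    case True
    then have "real (nat b * N) * f j = of_int (int N * a)" using ab by simp
    then show ?thesis by (metis Ints_of_int)
  next
    case False
    then have "of_int b * (real N * f j) \<in> \<int>" using that N(2) by (simp add: Ints_mult)
    moreover have "real (nat b * N) * f j = of_int b * (real N * f j)" using ab(1) by simp
    ultimately show ?thesis by presburger
  qed
  then show ?case using N(1) ab(1) by (intro exI[of _ "nat b * N"]) auto
qed (auto intro: exI[of _ 1])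

text \<open>
  A \<open>\<rat>\<close>-linear functional on the reals, obtained by extending \<open>x\<close> to a basis of \<open>\<real>\<close> over \<open>\<rat>\<close>.
\<close>

lemma rational_functional:
  fixes x :: real
  assumes "x \<noteq> 0"
  shows "\<exists>\<phi> :: real \<Rightarrow> real. \<phi> x \<noteq> 0 \<and> (\<forall>y. \<phi> y \<in> \<rat>) \<and> (\<forall>y z. \<phi> (y + z) = \<phi> y + \<phi> z) \<and>
    (\<forall>q\<in>\<rat>. \<forall>y. \<phi> (q * y) = q * \<phi> y)"
proof -
  interpret vector_space_pair "\<lambda>(q::rat) (y::real). of_rat q * y" "(*) :: rat \<Rightarrow> rat \<Rightarrow> rat"
    by unfold_locales (simp_all add: algebra_simps of_rat_add of_rat_mult)
  have "vs1.independent {x}" using assms by simp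
  then obtain g where g: "Vector_Spaces.linear (\<lambda>q y. of_rat q * y) (*) g" "g x = 1"
    using linear_independent_extend[of "{x}" "\<lambda>_. 1"] by auto
  then interpret g: Vector_Spaces.linear "\<lambda>(q::rat) (y::real). of_rat q * y" "(*) :: rat \<Rightarrow> rat \<Rightarrow> rat" g
    by simp
  show ?thesis
    by (rule exI[of _ "\<lambda>y. of_rat (g y)"])
      (auto simp: g g.add g.scale of_rat_add of_rat_mult elim!: Rats_cases)
qed

text \<open>
  Applying a \<open>\<rat>\<close>-linear functional \<open>\<phi>\<close> with \<open>\<phi> (c \<bullet> r) \<noteq> 0\<close> to each coordinate of \<open>r\<close> preserves rational
  linear relations. The result is therefore a rational vector in the kernel with cost \<open>\<phi> (c \<bullet> r)\<close>, and
  it vanishes where \<open>r\<close> does; clearing denominators makes it integral.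
\<close>

lemma integer_kernel_vector:
  fixes A :: "int ^ 'n ^ 'd" and c :: "real ^ 'n"
  assumes rational: "\<forall>i. c $ i \<in> \<rat>" and ker: "real_mat A *v r = 0" and "c \<bullet> r \<noteq> 0"
  shows "\<exists>q::int ^ 'n. A *v q = 0 \<and> c \<bullet> real_vec q \<noteq> 0 \<and> (\<forall>i. r $ i = 0 \<longrightarrow> q $ i = 0)"
proof -
  obtain \<phi> :: "real \<Rightarrow> real" where \<phi>: "\<phi> (c \<bullet> r) \<noteq> 0" "\<And>y. \<phi> y \<in> \<rat>" "\<And>y z. \<phi> (y + z) = \<phi> y + \<phi> z"
      "\<And>q y. q \<in> \<rat> \<Longrightarrow> \<phi> (q * y) = q * \<phi> y"
    using rational_functional[OF \<open>c \<bullet> r \<noteq> 0\<close>] by blast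
  have \<phi>0: "\<phi> 0 = 0" using \<phi>(3)[of 0 0] by simp
  have sum: "\<phi> (\<Sum>i\<in>UNIV. a i * r $ i) = (\<Sum>i\<in>UNIV. a i * \<phi> (r $ i))"
    if "\<And>i. a i \<in> \<rat>" for a :: "'n \<Rightarrow> real"
  proof -
    have "\<phi> (\<Sum>i\<in>F. a i * r $ i) = (\<Sum>i\<in>F. a i * \<phi> (r $ i))" if "finite F" for F
      using that by (induction F) (simp_all add: \<phi>0 \<phi>(3) \<phi>(4) \<open>\<And>i. a i \<in> \<rat>\<close>)
    then show ?thesis by simp
  qed
  obtain N where N: "0 < N" "\<And>i. real N * \<phi> (r $ i) \<in> \<int>"
    using common_denominator[of UNIV "\<lambda>i. \<phi> (r $ i)"] \<phi>(2) by auto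
  define q :: "int ^ 'n" where "q = (\<chi> i. \<lfloor>real N * \<phi> (r $ i)\<rfloor>)"
  have q: "real_of_int (q $ i) = real N * \<phi> (r $ i)" for i
    using N(2)[of i] by (simp add: q_def)
  have "real_of_int ((A *v q) $ k) = 0" for k
  proof -
    have "real_of_int ((A *v q) $ k) = real N * (\<Sum>i\<in>UNIV. real_of_int (A $ k $ i) * \<phi> (r $ i))"
      by (simp add: matrix_vector_mult_def q sum_distrib_left mult_ac)
    also have "\<dots> = real N * \<phi> (\<Sum>i\<in>UNIV. real_of_int (A $ k $ i) * r $ i)"
      by (subst sum) auto
    also have "(\<Sum>i\<in>UNIV. real_of_int (A $ k $ i) * r $ i) = (real_mat A *v r) $ k"
      by (simp add: real_mat_def map_matrix_def matrix_vector_mult_def)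
    finally show ?thesis by (simp add: ker \<phi>0)
  qed
  then have "A *v q = 0" by (simp add: vec_eq_iff)
  moreover have "c \<bullet> real_vec q = real N * \<phi> (c \<bullet> r)"
    using sum[of "\<lambda>i. c $ i"] rational
    by (simp add: inner_vec_def real_vec_def q sum_distrib_left mult_ac)
  then have "c \<bullet> real_vec q \<noteq> 0" using \<phi>(1) N(1) by simp
  moreover have "q $ i = 0" if "r $ i = 0" for i using q[of i] that \<phi>0 by simp
  ultimately show ?thesis by blast
qed

text \<open>
  An analogue of the finiteness of vertices. Let \<open>Z v\<close> be the set of tight inequalities at a feasible
  \<open>v\<close>. If some kernel vector vanishing on \<open>Z v\<close> has nonzero cost, there is an integer one of negative
  cost. Since it is not a ray, moving along it stops where a further inequality becomes tight. Hence
  every feasible point is dominated by a point of the set \<open>E\<close> where all such kernel vectors have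
  cost zero. On \<open>E\<close> the cost depends only on \<open>Z v\<close>, so it takes finitely many values there.
\<close>

lemma lp_minimum_exists:
  fixes A :: "int ^ 'n ^ 'd" and c :: "real ^ 'n" and y :: "real ^ 'd" and \<sigma> :: "'n set"
  defines "P \<equiv> {v. real_mat A *v v = y \<and> (\<forall>i\<in>\<sigma>. 0 \<le> v $ i)}"
  assumes rational: "\<forall>i. c $ i \<in> \<rat>" and feasible: "P \<noteq> {}"
    and no_ray: "\<And>r::int ^ 'n. A *v r = 0 \<Longrightarrow> \<forall>i\<in>\<sigma>. 0 \<le> r $ i \<Longrightarrow> 0 \<le> c \<bullet> real_vec r"
  shows "\<exists>v\<in>P. \<forall>w\<in>P. c \<bullet> v \<le> c \<bullet> w"
proof -
  define Z where "Z v = {i\<in>\<sigma>. v $ i = 0}" for v :: "real ^ 'n"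
  define L where "L v = {r. real_mat A *v r = 0 \<and> (\<forall>i\<in>Z v. r $ i = 0)}" for v
  have better: "\<exists>w\<in>P. c \<bullet> w \<le> c \<bullet> v \<and> Z v \<subset> Z w" if v: "v \<in> P" and r: "r \<in> L v" "c \<bullet> r \<noteq> 0" for v r
  proof -
    obtain q0 :: "int ^ 'n" where q0: "A *v q0 = 0" "c \<bullet> real_vec q0 \<noteq> 0" "\<And>i. r $ i = 0 \<Longrightarrow> q0 $ i = 0"
      using integer_kernel_vector[OF rational] r unfolding L_def by blast
    define q where "q = (if c \<bullet> real_vec q0 < 0 then q0 else - q0)"
    have neg: "real_vec (- q0) = - real_vec q0" "A *v (- q0) = - (A *v q0)"
      by (simp_all add: real_vec_def matrix_vector_mult_def vec_eq_iff sum_negf)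
    have q: "A *v q = 0" "c \<bullet> real_vec q < 0" "\<And>i. i \<in> Z v \<Longrightarrow> q $ i = 0"
      using q0 r(1) by (auto simp: q_def L_def neg)
    define T where "T = {i\<in>\<sigma>. q $ i < 0}"
    have "T \<noteq> {}" using no_ray[OF q(1)] q(2) by (force simp: T_def)
    \<comment> \<open>The largest step along \<open>q\<close> that stays feasible; it makes the inequality at a minimizer tight.\<close>
    define t where "t = Min ((\<lambda>i. v $ i / - real_of_int (q $ i)) ` T)"
    have "t \<in> (\<lambda>i. v $ i / - real_of_int (q $ i)) ` T"
      unfolding t_def using \<open>T \<noteq> {}\<close> by (intro Min_in) auto
    then obtain k where k: "k \<in> T" "t = v $ k / - real_of_int (q $ k)" by blast
    have t0: "0 \<le> t" using k v by (auto simp: T_def P_def intro!: divide_nonneg_neg divide_nonneg_pos)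
    define w where "w = v + t *\<^sub>R real_vec q"
    have wi: "w $ i = v $ i + t * real_of_int (q $ i)" for i by (simp add: w_def real_vec_def)
    have "0 \<le> w $ i" if i: "i \<in> \<sigma>" for i
    proof (cases "q $ i < 0")
      case True
      then have "t \<le> v $ i / - real_of_int (q $ i)" using i by (auto simp: t_def T_def)
      then show ?thesis using True by (simp add: wi field_simps)
    next
      case False
      then show ?thesis using t0 i v by (simp add: wi P_def)
    qed
    moreover have "real_mat A *v w = y"
      using v q(1) by (simp add: w_def matrix_vector_right_distrib matrix_vector_mult_scaleR
          real_mat_mult_real_vec P_def) (simp add: real_vec_def vec_eq_iff)
    moreover have "c \<bullet> w \<le> c \<bullet> v"
      using t0 q(2) by (simp add: w_def inner_add_right mult_nonneg_nonpos)
    moreover have "Z v \<subseteq> Z w" using q(3) by (auto simp: Z_def wi)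
    moreover have "k \<in> Z w - Z v" using k q(3) by (auto simp: Z_def wi T_def field_simps)
    ultimately show ?thesis by (auto simp: P_def)
  qed
  define E where "E = {v\<in>P. \<forall>r\<in>L v. c \<bullet> r = 0}"
  have dominated: "\<exists>w\<in>E. c \<bullet> w \<le> c \<bullet> v" if "v \<in> P" for v
    using that
  proof (induction "card (UNIV - Z v)" arbitrary: v rule: less_induct)
    case less
    show ?case
    proof (cases "v \<in> E")
      case False
      then obtain r where "r \<in> L v" "c \<bullet> r \<noteq> 0" using less.prems by (auto simp: E_def)
      then obtain w where w: "w \<in> P" "c \<bullet> w \<le> c \<bullet> v" "Z v \<subset> Z w" using better less.prems by blast
      have "card (UNIV - Z w) < card (UNIV - Z v)" using w(3) by (intro psubset_card_mono) auto
      then show ?thesis using less.hyps w by (meson order_trans)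
    qed auto
  qed
  \<comment> \<open>Two members of \<open>E\<close> with the same zero set differ by an element of \<open>L\<close>.\<close>
  have same: "c \<bullet> v = c \<bullet> w" if "v \<in> E" "w \<in> E" "Z v = Z w" for v w
  proof -
    have "v - w \<in> L v" using that by (auto simp: E_def L_def P_def Z_def matrix_vector_mult_diff_distrib)
    then have "c \<bullet> (v - w) = 0" using that by (auto simp: E_def)
    then show ?thesis by (simp add: inner_diff_right)
  qed
  have "c \<bullet> v = c \<bullet> inv_into E Z (Z v)" if v: "v \<in> E" for v
    using v by (intro same) (simp_all add: inv_into_into f_inv_into_f)
  then have "(\<lambda>v. c \<bullet> v) ` E = (\<lambda>v. c \<bullet> inv_into E Z (Z v)) ` E"
    by (rule image_cong[OF refl])
  also have "\<dots> = (\<lambda>z. c \<bullet> inv_into E Z z) ` Z ` E" by (simp only: image_image)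
  also have "finite \<dots>" by simp
  finally have fin: "finite ((\<lambda>v. c \<bullet> v) ` E)" .
  have ne: "(\<lambda>v. c \<bullet> v) ` E \<noteq> {}" using feasible dominated by blast
  obtain v where v: "v \<in> E" "c \<bullet> v = Min ((\<lambda>v. c \<bullet> v) ` E)"
    using Min_in[OF fin ne] by auto
  have "c \<bullet> v \<le> c \<bullet> w" if "w \<in> P" for w
    using dominated[OF that] v(2) Min_le[OF fin] by (metis imageI order_trans)
  then show ?thesis using v(1) by (auto simp: E_def)
qed

section \<open>Optimal exponents and optimal solutions\<close>

lemma nonoptimal_iff:
  "nonoptimal A c u \<longleftrightarrow> (\<exists>w::int ^ 'n. A *v w = A *v int_vec u \<and> (\<forall>i. 0 \<le> w $ i) \<and>
     c \<bullet> real_vec w < c \<bullet> real_vec (int_vec u))"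
  unfolding nonoptimal_def ip_optimal_def is_arg_min_def ip_feasible_def
  by (simp add: int_vec_def)

lemma real_vec_add: "real_vec (u + v) = real_vec u + real_vec v"
  by (simp add: real_vec_def vec_eq_iff)

lemma int_vec_add: "int_vec (u + v) = int_vec u + int_vec v"
  by (simp add: int_vec_def vec_eq_iff)

text \<open>Adding \<open>z\<close> to a cheaper competitor of \<open>w\<close> yields a cheaper competitor of \<open>z + w\<close>.\<close>

lemma nonoptimal_add:
  assumes "nonoptimal A c w"
  shows "nonoptimal A c (z + w)"
proof -
  obtain v where v: "A *v v = A *v int_vec w" "\<forall>i. 0 \<le> v $ i" "c \<bullet> real_vec v < c \<bullet> real_vec (int_vec w)"
    using assms unfolding nonoptimal_iff by blast
  then show ?thesis unfolding nonoptimal_iff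
    by (intro exI[of _ "int_vec z + v"])
      (simp add: int_vec_add real_vec_add matrix_vector_right_distrib inner_add_right, simp add: int_vec_def)
qed

lemma nonoptimal_ideal_eq:
  "nonoptimal_ideal A c = {p. Poly_Mapping.keys p \<subseteq> Collect (nonoptimal A c)}"
proof -
  have "{xpow u | u. nonoptimal A c u} = (\<lambda>u. Poly_Mapping.single u 1) ` Collect (nonoptimal A c)"
    by (auto simp: xpow_eq_single)
  moreover have "(\<exists>u\<in>Collect (nonoptimal A c). \<exists>z. w = z + u) \<longleftrightarrow> w \<in> Collect (nonoptimal A c)" for w
  proof
    assume "w \<in> Collect (nonoptimal A c)"
    moreover have "w = 0 + w" by simp
    ultimately show "\<exists>u\<in>Collect (nonoptimal A c). \<exists>z. w = z + u" by blast
  qed (use nonoptimal_add in blast)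
  ultimately show ?thesis
    unfolding nonoptimal_ideal_def by (simp only: ideal_generated_monomials subset_eq)
qed

lemma nonoptimal_ideal_subset_iff:
  "nonoptimal_ideal A c \<subseteq> irreducible_ideal \<sigma> u \<longleftrightarrow> (\<forall>w\<in>standard_box \<sigma> u. \<not> nonoptimal A c w)"
proof
  assume sub: "nonoptimal_ideal A c \<subseteq> irreducible_ideal \<sigma> u"
  show "\<forall>w\<in>standard_box \<sigma> u. \<not> nonoptimal A c w"
  proof (intro ballI notI)
    fix w assume "w \<in> standard_box \<sigma> u" "nonoptimal A c w"
    moreover have "Poly_Mapping.single w 1 \<in> nonoptimal_ideal A c"
      using \<open>nonoptimal A c w\<close> by (simp add: nonoptimal_ideal_eq)
    ultimately show False using sub by (auto simp: irreducible_ideal_eq)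
  qed
qed (auto simp: nonoptimal_ideal_eq irreducible_ideal_eq)

lemma int_vec_nat:
  fixes u :: "int ^ 'n"
  assumes "\<forall>i. 0 \<le> u $ i"
  obtains w where "u = int_vec w"
proof
  show "u = int_vec (\<chi> i. nat (u $ i))" using assms by (simp add: int_vec_def vec_eq_iff)
qed

locale bounded_integer_programs =
  fixes A :: "int ^ 'n ^ 'd" and c :: "real ^ 'n"
  assumes rational: "\<forall>i. c $ i \<in> \<rat>"
    and bounded: "\<forall>b. ip_bounded A c b"
begin

text \<open>
  With \<open>N\<close> a common denominator of \<open>c\<close>, the scaled costs \<open>f u\<close> are integers bounded below.
\<close>

lemma ip_optimal_exists:
  assumes "ip_feasible A b u0"
  shows "\<exists>u. ip_optimal A c b u"
proof -
  obtain N where N: "0 < N" "\<And>i. real N * c $ i \<in> \<int>"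
    using common_denominator[of UNIV "\<lambda>i. c $ i"] rational by auto
  define f where "f u = \<lfloor>real N * (c \<bullet> real_vec u)\<rfloor>" for u
  have f: "real_of_int (f u) = real N * (c \<bullet> real_vec u)" for u
  proof -
    have "real N * (c \<bullet> real_vec u) = (\<Sum>i\<in>UNIV. (real N * c $ i) * real_of_int (u $ i))"
      by (simp add: inner_vec_def real_vec_def sum_distrib_left mult_ac)
    also have "\<dots> \<in> \<int>" using N(2) by (intro Ints_sum) (rule Ints_mult, simp_all)
    finally show ?thesis by (simp add: f_def)
  qed
  have less: "f u < f v \<longleftrightarrow> c \<bullet> real_vec u < c \<bullet> real_vec v" for u v
    using N(1) by (metis f mult_less_cancel_left_pos of_int_less_iff of_nat_0_less_iff)
  obtain m where m: "\<And>u. ip_feasible A b u \<Longrightarrow> m \<le> c \<bullet> real_vec u"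
    using bounded unfolding ip_bounded_def bdd_below_def by blast
  have "\<lfloor>real N * m\<rfloor> \<le> f u" if "ip_feasible A b u" for u
    unfolding f_def using m[OF that] N(1) by (intro floor_mono mult_left_mono) auto
  then obtain u where "ip_feasible A b u" "\<And>v. ip_feasible A b v \<Longrightarrow> nat (f u - \<lfloor>real N * m\<rfloor>) \<le> nat (f v - \<lfloor>real N * m\<rfloor>)"
    using assms ex_has_least_nat[of "ip_feasible A b" u0 "\<lambda>u. nat (f u - \<lfloor>real N * m\<rfloor>)"] by auto
  then have "ip_feasible A b u" "\<And>v. ip_feasible A b v \<Longrightarrow> f u \<le> f v"
    using \<open>\<And>u. ip_feasible A b u \<Longrightarrow> \<lfloor>real N * m\<rfloor> \<le> f u\<close> by force+
  then show ?thesis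
    unfolding ip_optimal_def is_arg_min_def using less by (metis not_less)
qed

text \<open>
  Off \<open>\<sigma>\<close> the box is unbounded, so it contains a vector \<open>w\<close> for which \<open>w + r\<close> is nonnegative. If \<open>r\<close> had
  negative cost, \<open>w + r\<close> would show that \<open>w\<close> is non-optimal.
\<close>

lemma recession_cost_nonneg:
  assumes opt: "\<forall>w\<in>standard_box \<sigma> u. \<not> nonoptimal A c w"
    and r: "A *v r = 0" "\<forall>i\<in>\<sigma>. 0 \<le> r $ i"
  shows "0 \<le> c \<bullet> real_vec r"
proof (rule ccontr)
  assume neg: "\<not> 0 \<le> c \<bullet> real_vec r"
  define w where "w = (\<chi> i. if i \<in> \<sigma> then 0 else nat (- (r $ i)))"
  have "w \<in> standard_box \<sigma> u" by (simp add: w_def standard_box_def)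
  moreover have "nonoptimal A c w"
    unfolding nonoptimal_iff
    using neg r by (intro exI[of _ "int_vec w + r"])
      (simp add: matrix_vector_right_distrib real_vec_add inner_add_right, simp add: int_vec_def w_def)
  ultimately show False using opt by blast
qed

text \<open>
  A cheaper competitor of \<open>0\<close> could be scaled up, making the program with right-hand side \<open>0\<close>
  unbounded. So \<open>M(A,c)\<close> is a proper ideal and has a component, and the box \<open>{0}\<close> consists of
  optimal exponents.
\<close>

lemma zero_optimal: "\<not> nonoptimal A c 0"
proof
  have zero: "int_vec 0 = (0 :: int ^ 'n)" "real_vec (0 :: int ^ 'n) = 0" "A *v 0 = 0" "c \<bullet> 0 = 0"
    by (simp_all add: int_vec_def real_vec_def vec_eq_iff)
  assume "nonoptimal A c 0"
  then obtain w where w: "A *v w = 0" "\<forall>i. 0 \<le> w $ i" "c \<bullet> real_vec w < 0"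
    unfolding nonoptimal_iff zero by auto
  obtain m where m: "\<And>u. ip_feasible A 0 u \<Longrightarrow> m \<le> c \<bullet> real_vec u"
    using bounded unfolding ip_bounded_def bdd_below_def by blast
  have "0 < - (c \<bullet> real_vec w)" using w(3) by simp
  from reals_Archimedean3[OF this] obtain k :: nat where k: "- m < real k * - (c \<bullet> real_vec w)"
    by blast
  have "real_vec (int k *s w) = real k *\<^sub>R real_vec w" by (simp add: real_vec_def vec_eq_iff)
  moreover have "A *v (int k *s w) = int k *s (A *v w)"
    by (simp add: matrix_vector_mult_def vec_eq_iff sum_distrib_left mult_ac)
  then have "ip_feasible A 0 (int k *s w)"
    using w(1,2) by (simp add: ip_feasible_def)
  ultimately have "m \<le> real k * (c \<bullet> real_vec w)" using m by fastforce
  then show False using k by simp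
qed

text \<open>The rays of the relaxation are those of the program of the box \<open>{0}\<close>, in which all signs count.\<close>

lemma lp_optimal_exists:
  assumes "lp_feasible A b v0"
  shows "\<exists>v. lp_optimal A c b v"
proof -
  have "w = 0" if "w \<in> standard_box UNIV 0" for w :: "nat ^ 'n"
    using that by (simp add: standard_box_def vec_eq_iff)
  then have "\<forall>w\<in>standard_box UNIV 0. \<not> nonoptimal A c w"
    using zero_optimal by metis
  then have "\<exists>v\<in>{v. real_mat A *v v = real_vec b \<and> (\<forall>i\<in>UNIV. 0 \<le> v $ i)}.
      \<forall>w\<in>{v. real_mat A *v v = real_vec b \<and> (\<forall>i\<in>UNIV. 0 \<le> v $ i)}. c \<bullet> v \<le> c \<bullet> w"
    using assms rational by (intro lp_minimum_exists recession_cost_nonneg[of UNIV 0]) (auto simp: lp_feasible_def)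
  then obtain v where "real_mat A *v v = real_vec b" "\<forall>i. 0 \<le> v $ i"
      "\<And>w. real_mat A *v w = real_vec b \<Longrightarrow> \<forall>i. 0 \<le> w $ i \<Longrightarrow> c \<bullet> v \<le> c \<bullet> w"
    by auto
  then have "lp_optimal A c b v"
    unfolding lp_optimal_def is_arg_min_def lp_feasible_def by (meson not_less)
  then show ?thesis by (rule exI)
qed

lemma difference_exists:
  assumes "ip_feasible A b u"
  shows "\<exists>z. is_ip_lp_difference A c b z"
proof -
  have "lp_feasible A b (real_vec u)"
    using assms by (auto simp: ip_feasible_def lp_feasible_def real_mat_mult_real_vec) (simp add: real_vec_def)
  then show ?thesis
    using lp_optimal_exists ip_optimal_exists[OF assms] unfolding is_ip_lp_difference_def by blast
qed

end

section \<open>Gap values and the gap\<close>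

definition restrict_vec :: "'n set \<Rightarrow> nat ^ 'n \<Rightarrow> real ^ 'n" where
  "restrict_vec \<sigma> u = (\<chi> i. if i \<in> \<sigma> then real (u $ i) else 0)"

lemma gap_lp_feasible_iff:
  "gap_lp_feasible A \<sigma> u v \<longleftrightarrow>
     real_mat A *v v = real_mat A *v restrict_vec \<sigma> u \<and> (\<forall>i\<in>\<sigma>. 0 \<le> v $ i)"
proof -
  have "real_mat A *v restrict_vec \<sigma> u =
      (\<Sum>i\<in>UNIV. if i \<in> \<sigma> then real (u $ i) *\<^sub>R column i (real_mat A) else 0)"
    unfolding matrix_mult_sum restrict_vec_def
    by (intro sum.cong) (auto simp: scalar_mult_eq_scaleR)
  then show ?thesis by (simp add: gap_lp_feasible_def sum.If_cases)
qed

lemma gap_lp_objective_eq: "gap_lp_objective c \<sigma> u v = c \<bullet> restrict_vec \<sigma> u - c \<bullet> v"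
proof -
  have "c \<bullet> restrict_vec \<sigma> u = (\<Sum>i\<in>UNIV. if i \<in> \<sigma> then real (u $ i) * c $ i else 0)"
    unfolding inner_vec_def restrict_vec_def by (intro sum.cong) auto
  then show ?thesis by (simp add: gap_lp_objective_def sum.If_cases)
qed

lemma gap_value_unique:
  assumes "is_gap_value A c I y" "is_gap_value A c I z"
  shows "y = z"
proof -
  obtain \<sigma> u v where u: "I = irreducible_ideal \<sigma> u"
      "is_arg_max (gap_lp_objective c \<sigma> u) (gap_lp_feasible A \<sigma> u) v" "y = gap_lp_objective c \<sigma> u v"
    using assms(1) unfolding is_gap_value_def by blast
  obtain \<tau> s w where s: "I = irreducible_ideal \<tau> s"
      "is_arg_max (gap_lp_objective c \<tau> s) (gap_lp_feasible A \<tau> s) w" "z = gap_lp_objective c \<tau> s w"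
    using assms(2) unfolding is_gap_value_def by blast
  have "irreducible_ideal \<sigma> u = irreducible_ideal \<tau> s" using u(1) s(1) by simp
  then have "\<sigma> = \<tau>" "\<forall>i\<in>\<sigma>. u $ i = s $ i" by (rule irreducible_ideal_unique)+
  then have "restrict_vec \<sigma> u = restrict_vec \<tau> s" by (simp add: restrict_vec_def vec_eq_iff)
  then have "gap_lp_feasible A \<sigma> u = gap_lp_feasible A \<tau> s"
      "gap_lp_objective c \<sigma> u = gap_lp_objective c \<tau> s"
    using \<open>\<sigma> = \<tau>\<close> by (simp_all add: fun_eq_iff gap_lp_feasible_iff gap_lp_objective_eq)
  then show ?thesis
    using u(2,3) s(2,3) unfolding is_arg_max_def by (metis linorder_neqE)
qed

context bounded_integer_programs
begin

lemma gap_lp_maximum_exists: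
  assumes "\<forall>w\<in>standard_box \<sigma> u. \<not> nonoptimal A c w"
  shows "\<exists>v. is_arg_max (gap_lp_objective c \<sigma> u) (gap_lp_feasible A \<sigma> u) v"
proof -
  let ?P = "{v. real_mat A *v v = real_mat A *v restrict_vec \<sigma> u \<and> (\<forall>i\<in>\<sigma>. 0 \<le> v $ i)}"
  have "restrict_vec \<sigma> u \<in> ?P" by (simp add: restrict_vec_def)
  then have "\<exists>v\<in>?P. \<forall>w\<in>?P. c \<bullet> v \<le> c \<bullet> w"
    using rational recession_cost_nonneg[OF assms] by (intro lp_minimum_exists) blast+
  then obtain v where v: "gap_lp_feasible A \<sigma> u v"
      "\<And>w. gap_lp_feasible A \<sigma> u w \<Longrightarrow> c \<bullet> v \<le> c \<bullet> w"
    unfolding gap_lp_feasible_iff by auto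
  then have "gap_lp_objective c \<sigma> u w \<le> gap_lp_objective c \<sigma> u v" if "gap_lp_feasible A \<sigma> u w" for w
    using that by (simp add: gap_lp_objective_eq)
  then have "is_arg_max (gap_lp_objective c \<sigma> u) (gap_lp_feasible A \<sigma> u) v"
    unfolding is_arg_max_def using v(1) by (meson not_less)
  then show ?thesis by (rule exI)
qed

text \<open>
  The integer program is the one solved by \<open>w\<close>, which equals \<open>u\<close> on \<open>\<sigma>\<close>. Off \<open>\<sigma>\<close> it is large enough for
  the shift of \<open>v\<close> by \<open>t = w - u\<^sub>\<sigma>\<close> to be feasible for the relaxation; this shift adds the same cost to \<open>v\<close>
  and to \<open>u\<^sub>\<sigma>\<close>.
\<close>

lemma gap_lp_le_difference:
  assumes opt: "\<forall>w\<in>standard_box \<sigma> u. \<not> nonoptimal A c w" and v: "gap_lp_feasible A \<sigma> u v"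
  shows "\<exists>b z. (\<exists>u. ip_feasible A b u) \<and> is_ip_lp_difference A c b z \<and> gap_lp_objective c \<sigma> u v \<le> z"
proof -
  define w where "w = (\<chi> i. if i \<in> \<sigma> then u $ i else nat \<lceil>- v $ i\<rceil>)"
  define t where "t = real_vec (int_vec w) - restrict_vec \<sigma> u"
  have "\<not> nonoptimal A c w" using opt by (simp add: w_def standard_box_def)
  then have w: "ip_optimal A c (A *v int_vec w) (int_vec w)" by (simp add: nonoptimal_def)
  then have feas: "ip_feasible A (A *v int_vec w) (int_vec w)" by (simp add: ip_optimal_def is_arg_min_def)
  have "0 \<le> (v + t) $ i" for i
  proof (cases "i \<in> \<sigma>")
    case True
    then show ?thesis using v by (simp add: t_def w_def real_vec_def int_vec_def restrict_vec_def gap_lp_feasible_iff)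
  next
    case False
    then have "(v + t) $ i = v $ i + real (nat \<lceil>- v $ i\<rceil>)"
      by (simp add: t_def w_def real_vec_def int_vec_def restrict_vec_def)
    then show ?thesis by linarith
  qed
  then have lp: "lp_feasible A (A *v int_vec w) (v + t)"
    using v by (simp add: lp_feasible_def gap_lp_feasible_iff t_def matrix_vector_right_distrib
        matrix_vector_mult_diff_distrib real_mat_mult_real_vec)
  obtain v' where v': "lp_optimal A c (A *v int_vec w) v'" using lp_optimal_exists[OF lp] by blast
  then have "c \<bullet> v' \<le> c \<bullet> (v + t)" using lp by (auto simp: lp_optimal_def is_arg_min_def not_less)
  then have "gap_lp_objective c \<sigma> u v \<le> c \<bullet> real_vec (int_vec w) - c \<bullet> v'"
    by (simp add: gap_lp_objective_eq t_def inner_add_right inner_diff_right)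
  then show ?thesis using w v' feas unfolding is_ip_lp_difference_def by blast
qed

text \<open>
  The reverse translation. Feasibility on \<open>\<sigma>\<close> uses that \<open>w\<close> is below \<open>u\<close> there, that is, that \<open>w\<close> is in the box.
\<close>

lemma difference_attained_in_gap_lp:
  assumes w: "w \<in> standard_box \<sigma> u" and v: "lp_feasible A (A *v int_vec w) v"
  shows "\<exists>v'. gap_lp_feasible A \<sigma> u v' \<and> gap_lp_objective c \<sigma> u v' = c \<bullet> real_vec (int_vec w) - c \<bullet> v"
proof (intro exI conjI)
  let ?v = "v + (restrict_vec \<sigma> u - real_vec (int_vec w))"
  show "gap_lp_feasible A \<sigma> u ?v"
    unfolding gap_lp_feasible_iff
  proof (intro conjI ballI)
    fix i assume "i \<in> \<sigma>"
    moreover have "0 \<le> v $ i" using v by (simp add: lp_feasible_def)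
    ultimately show "0 \<le> ?v $ i"
      using w by (auto simp: standard_box_def restrict_vec_def real_vec_def int_vec_def)
  qed (use v in \<open>simp add: lp_feasible_def matrix_vector_right_distrib
      matrix_vector_mult_diff_distrib real_mat_mult_real_vec\<close>)
  show "gap_lp_objective c \<sigma> u ?v = c \<bullet> real_vec (int_vec w) - c \<bullet> v"
    by (simp add: gap_lp_objective_eq inner_add_right inner_diff_right)
qed

text \<open>A component contains \<open>M(A,c)\<close>, so non-optimal exponents are not in its box.\<close>

lemma component_optimal:
  assumes "irreducible_ideal \<sigma> u \<in> irreducible_components (nonoptimal_ideal A c)"
  shows "\<forall>w\<in>standard_box \<sigma> u. \<not> nonoptimal A c w"
proof -
  obtain C where C: "irreducible_ideal \<sigma> u \<in> C" "irredundant_decomposition (nonoptimal_ideal A c) C"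
    using assms unfolding irreducible_components_def by blast
  have "\<Inter>C = nonoptimal_ideal A c" using C(2) by (simp add: irredundant_decomposition_def)
  then have "nonoptimal_ideal A c \<subseteq> irreducible_ideal \<sigma> u" using C(1) by blast
  then show ?thesis by (simp only: nonoptimal_ideal_subset_iff)
qed

lemma component_cases:
  assumes "I \<in> irreducible_components (nonoptimal_ideal A c)"
  obtains \<sigma> u where "I = irreducible_ideal \<sigma> u"
proof -
  obtain C where "I \<in> C" "irredundant_decomposition (nonoptimal_ideal A c) C"
    using assms unfolding irreducible_components_def by blast
  then have "\<exists>\<sigma> u. I = irreducible_ideal \<sigma> u" by (simp add: irredundant_decomposition_def)
  then show ?thesis using that by blast
qed

lemma gap_value_exists:
  assumes I: "I \<in> irreducible_components (nonoptimal_ideal A c)"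
  shows "\<exists>z. is_gap_value A c I z"
proof -
  obtain \<sigma> u where u: "I = irreducible_ideal \<sigma> u" using component_cases[OF I] .
  obtain v where "is_arg_max (gap_lp_objective c \<sigma> u) (gap_lp_feasible A \<sigma> u) v"
    using gap_lp_maximum_exists[OF component_optimal] I u by blast
  then show ?thesis unfolding is_gap_value_def using u by blast
qed

lemma gap_value_le_difference:
  assumes I: "I \<in> irreducible_components (nonoptimal_ideal A c)" and z: "is_gap_value A c I z"
  shows "\<exists>b y. (\<exists>u. ip_feasible A b u) \<and> is_ip_lp_difference A c b y \<and> z \<le> y"
proof -
  obtain \<sigma> u v where u: "I = irreducible_ideal \<sigma> u" "gap_lp_feasible A \<sigma> u v"
      "z = gap_lp_objective c \<sigma> u v"
    using z unfolding is_gap_value_def is_arg_max_def by blast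
  then show ?thesis using gap_lp_le_difference[OF component_optimal] I by blast
qed

text \<open>
  The integer optimum at \<open>b\<close> is an optimal exponent, so its monomial is missing from some member \<open>I\<close> of
  the decomposition; that is, the optimum lies in the box of \<open>I\<close>.
\<close>

lemma difference_le_gap_value:
  assumes C: "irredundant_decomposition (nonoptimal_ideal A c) C" and y: "is_ip_lp_difference A c b y"
  shows "\<exists>I\<in>C. \<exists>z. is_gap_value A c I z \<and> y \<le> z"
proof -
  obtain u v where u: "ip_optimal A c b u" and v: "lp_optimal A c b v" and y: "y = c \<bullet> real_vec u - c \<bullet> v"
    using y unfolding is_ip_lp_difference_def by blast
  have fu: "A *v u = b" "\<forall>i. 0 \<le> u $ i" using u by (auto simp: ip_optimal_def is_arg_min_def ip_feasible_def)
  obtain w where w: "u = int_vec w" using int_vec_nat fu(2) by blast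
  have "\<not> nonoptimal A c w" using u fu(1) by (simp add: nonoptimal_def w)
  then have "Poly_Mapping.single w 1 \<notin> \<Inter>C"
    using C by (simp add: irredundant_decomposition_def nonoptimal_ideal_eq)
  then obtain I where I: "I \<in> C" "Poly_Mapping.single w 1 \<notin> I" by blast
  then have "\<exists>\<sigma> s. I = irreducible_ideal \<sigma> s" using C by (simp add: irredundant_decomposition_def)
  then obtain \<sigma> s where s: "I = irreducible_ideal \<sigma> s" by blast
  have box: "w \<in> standard_box \<sigma> s" using I(2) by (simp add: s irreducible_ideal_eq)
  have "lp_feasible A (A *v int_vec w) v" using v fu(1) w by (simp add: lp_optimal_def is_arg_min_def)
  then obtain v' where v': "gap_lp_feasible A \<sigma> s v'" "gap_lp_objective c \<sigma> s v' = y"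
    using difference_attained_in_gap_lp[OF box] y w by blast
  have "I \<in> irreducible_components (nonoptimal_ideal A c)"
    using C I(1) unfolding irreducible_components_def by blast
  then obtain x where x: "is_arg_max (gap_lp_objective c \<sigma> s) (gap_lp_feasible A \<sigma> s) x"
    using gap_lp_maximum_exists[OF component_optimal] s by blast
  then have "y \<le> gap_lp_objective c \<sigma> s x" using v' by (auto simp: is_arg_max_def not_less)
  then show ?thesis using I(1) s x unfolding is_gap_value_def by blast
qed

end

text \<open>
  The maximum \<open>g\<close> is taken over one decomposition \<open>C\<close> and bounds every difference. Gap values of
  components from any other decomposition are bounded by \<open>g\<close> as well, since each is at most some
  difference.
\<close>

theorem theorem1p1:
  fixes A :: "int ^ 'n ^ 'd" and c :: "real ^ 'n"
  assumes rational: "\<forall>i. c $ i \<in> \<rat>"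
    and bounded: "\<forall>b. ip_bounded A c b"
  shows "\<exists>g. is_gap A c g \<and>
           is_maximum_of (is_gap_value A c) (irreducible_components (nonoptimal_ideal A c)) g"
proof -
  interpret bounded_integer_programs A c using rational bounded by unfold_locales
  let ?M = "nonoptimal_ideal A c"
  obtain C where C: "irredundant_decomposition ?M C"
    unfolding nonoptimal_ideal_eq
    using irredundant_decomposition_exists[of "Collect (nonoptimal A c)"] nonoptimal_add[of A c] by auto
  have comp: "C \<subseteq> irreducible_components ?M" using C by (auto simp: irreducible_components_def)
  have "finite C" using C by (simp add: irredundant_decomposition_def)
  have "Poly_Mapping.single 0 1 \<notin> \<Inter>C"
    using C zero_optimal by (simp add: irredundant_decomposition_def nonoptimal_ideal_eq)
  then have "C \<noteq> {}" by blast
  obtain \<gamma> where \<gamma>: "\<And>I. I \<in> C \<Longrightarrow> is_gap_value A c I (\<gamma> I)"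
    using gap_value_exists comp by (metis subsetD)
  define g where "g = Max (\<gamma> ` C)"
  have difference_le: "y \<le> g" if y: "is_ip_lp_difference A c b y" for b y
  proof -
    obtain I z where I: "I \<in> C" and z: "is_gap_value A c I z" "y \<le> z"
      using difference_le_gap_value[OF C y] by blast
    have "z = \<gamma> I" using gap_value_unique[OF z(1) \<gamma>[OF I]] .
    then show ?thesis using z(2) I \<open>finite C\<close> by (auto simp: g_def intro: order_trans)
  qed
  have "g \<in> \<gamma> ` C" unfolding g_def using \<open>finite C\<close> \<open>C \<noteq> {}\<close> by (intro Max_in) auto
  then obtain I where I: "I \<in> C" "is_gap_value A c I g" using \<gamma> by blast
  then obtain b y where b: "\<exists>u. ip_feasible A b u" "is_ip_lp_difference A c b y" "g \<le> y"
    using gap_value_le_difference comp by blast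
  then have "is_ip_lp_difference A c b g" using difference_le by (metis order_antisym)
  then have "is_gap A c g"
    unfolding is_gap_def is_maximum_of_def using difference_exists difference_le b(1) bounded by blast
  moreover have "is_maximum_of (is_gap_value A c) (irreducible_components ?M) g"
    unfolding is_maximum_of_def
    using I comp gap_value_exists gap_value_le_difference difference_le by (meson order_trans subsetD)
  ultimately show ?thesis by blast
qed

end
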